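(* Let $\mathscr H$ be a complex Hilbert space, let $\mathfrak M$ be a nonempty set of bounded self-adjoint operators on $\mathscr H$ that is bounded from below, and let $M$ be a lower bound of $\mathfrak M$. (1) If $$\bigcap_{A\in\mathfrak M}\mathscr R\bigl((A-M)^{1/2}\bigr)=\{0\},\qquad( * )$$ then $M$ is a maximal lower bound of $\mathfrak M$. (2) If, additionally, $\mathfrak M$ is a finite set and $( * )$ is not true, then $M$ is not a maximal lower bound of $\mathfrak M$.
   Context: $\mathfrak S$ denotes the real vector space of bounded self-adjoint operators on $\mathscr H$, with Löwner's order: $S\le T$ iff $(Su,u)\le (Tu,u)$ for all $u\in\mathscr H$; $S$ is positive if $S\ge 0$, and $S^{1/2}$ is then its unique positive square root. $\mathscr R(S)$ is the range of $S$. An operator $L\in\mathfrak S$ is a lower bound of $\mathfrak M$ if $L\le A$ for all $A\in\mathfrak M$; $\mathfrak M$ is bounded from below if it has a lower bound. A maximal lower bound is a maximal element $M$ of the set $\mathfrak L$ of all lower bounds: $L\in\mathfrak L$ and $M\le L$ imply $L=M$. *)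

theory Defs
  imports "HOL-Analysis.Analysis"
begin

text \<open>
  A complex inner product space is built on top of its underlying real inner product space, so
  that the norm, the topology and bounded linear maps are those of the library. The real inner
  product is the real part of the complex one, hence norm x = sqrt (Re (cinner x x)), and
  positive definiteness of the complex inner product is inherited (see \<open>cinner_self\<close>).
  The complex inner product is linear in its first argument.
\<close>

class complex_inner = real_inner +
  fixes scaleC :: "complex \<Rightarrow> 'a \<Rightarrow> 'a" (infixr \<open>*\<^sub>C\<close> 75)
    and cinner :: "'a \<Rightarrow> 'a \<Rightarrow> complex"
  assumes scaleC_add_right: "c *\<^sub>C (x + y) = c *\<^sub>C x + c *\<^sub>C y"
    and scaleC_add_left: "(c + d) *\<^sub>C x = c *\<^sub>C x + d *\<^sub>C x"
    and scaleC_scaleC: "c *\<^sub>C d *\<^sub>C x = (c * d) *\<^sub>C x"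
    and scaleR_scaleC: "r *\<^sub>R x = complex_of_real r *\<^sub>C x"
    and cinner_commute: "cinner x y = cnj (cinner y x)"
    and cinner_add_left: "cinner (x + y) z = cinner x z + cinner y z"
    and cinner_scaleC_left: "cinner (c *\<^sub>C x) y = c * cinner x y"
    and inner_eq_Re_cinner: "inner x y = Re (cinner x y)"

class chilbert_space = complex_inner + complete_space

lemma cinner_self: "cinner x x = complex_of_real ((norm x)\<^sup>2)"
proof -
  have "Im (cinner x x) = 0"
    using arg_cong[OF cinner_commute[of x x], of Im] by simp
  then show ?thesis
    by (simp add: complex_eq_iff power2_norm_eq_inner inner_eq_Re_cinner)
qed

instantiation complex :: chilbert_space
begin

definition scaleC_complex :: "complex \<Rightarrow> complex \<Rightarrow> complex"
  where "scaleC_complex c x = c * x"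

definition cinner_complex :: "complex \<Rightarrow> complex \<Rightarrow> complex"
  where "cinner_complex x y = x * cnj y"

instance
  by standard
    (simp_all add: scaleC_complex_def cinner_complex_def algebra_simps scaleR_conv_of_real
      inner_complex_def)

end

text \<open>
  The library type of bounded real-linear maps is cut down to the complex-linear, self-adjoint ones.
\<close>

definition selfadjoint_ops :: "('a::complex_inner \<Rightarrow>\<^sub>L 'a) set"
  where "selfadjoint_ops = {S.
    (\<forall>c u. blinfun_apply S (c *\<^sub>C u) = c *\<^sub>C blinfun_apply S u) \<and>
    (\<forall>u v. cinner (blinfun_apply S u) v = cinner u (blinfun_apply S v))}"

text \<open>
  For self-adjoint operators the quadratic form is real-valued, so comparing real parts
  is comparing the values themselves.
\<close>

lemma selfadjoint_ops_form_real:
  assumes "S \<in> selfadjoint_ops"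
  shows "cinner (blinfun_apply S u) u \<in> \<real>"
proof -
  have "cinner (blinfun_apply S u) u = cnj (cinner (blinfun_apply S u) u)"
    using assms cinner_commute[of u "blinfun_apply S u"] by (simp add: selfadjoint_ops_def)
  then show ?thesis
    by (simp add: Reals_cnj_iff)
qed

definition loewner_le :: "('a::complex_inner \<Rightarrow>\<^sub>L 'a) \<Rightarrow> ('a \<Rightarrow>\<^sub>L 'a) \<Rightarrow> bool" (infix \<open>\<preceq>\<close> 50)
  where "S \<preceq> T \<longleftrightarrow>
    (\<forall>u. Re (cinner (blinfun_apply S u) u) \<le> Re (cinner (blinfun_apply T u) u))"

text \<open>The unique positive square root; meaningful only for positive S on a Hilbert space.\<close>

definition op_sqrt :: "('a::chilbert_space \<Rightarrow>\<^sub>L 'a) \<Rightarrow> ('a \<Rightarrow>\<^sub>L 'a)"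
  where "op_sqrt S = (THE T. T \<in> selfadjoint_ops \<and> 0 \<preceq> T \<and> T o\<^sub>L T = S)"

definition is_lower_bound :: "('a::complex_inner \<Rightarrow>\<^sub>L 'a) set \<Rightarrow> ('a \<Rightarrow>\<^sub>L 'a) \<Rightarrow> bool"
  where "is_lower_bound \<MM> L \<longleftrightarrow> L \<in> selfadjoint_ops \<and> (\<forall>A\<in>\<MM>. L \<preceq> A)"

definition bounded_from_below :: "('a::complex_inner \<Rightarrow>\<^sub>L 'a) set \<Rightarrow> bool"
  where "bounded_from_below \<MM> \<longleftrightarrow> (\<exists>L. is_lower_bound \<MM> L)"

definition is_maximal_lower_bound :: "('a::complex_inner \<Rightarrow>\<^sub>L 'a) set \<Rightarrow> ('a \<Rightarrow>\<^sub>L 'a) \<Rightarrow> bool"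
  where "is_maximal_lower_bound \<MM> M \<longleftrightarrow>
    is_lower_bound \<MM> M \<and> (\<forall>L. is_lower_bound \<MM> L \<and> M \<preceq> L \<longrightarrow> L = M)"

end

theory Submission
  imports Defs
begin

text \<open>
  Put \<open>D = L - M\<close> for a lower bound \<open>L\<close> above \<open>M\<close>. Then \<open>0 \<le> D \<le> A - M\<close> for every
  \<open>A\<close> in the family, and such a \<open>D\<close> has its range inside the range of the square root \<open>T\<close> of
  \<open>A - M\<close>: the Cauchy-Schwarz inequality for the form of \<open>D\<close> bounds \<open>(D u, v)\<close> by a
  multiple of \<open>\<parallel>T v\<parallel>\<close>, and for symmetric \<open>T\<close> a vector \<open>y\<close> lies in the range of \<open>T\<close> as soon
  as \<open>(y, v) \<le> C \<parallel>T v\<parallel>\<close> for all \<open>v\<close> (\<open>in_range_symmetric_if_bounded\<close>, the one place where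
  completeness enters the geometry). If the ranges meet only in \<open>0\<close>, then \<open>D = 0\<close>, which is
  maximality.

  Conversely, let \<open>y \<noteq> 0\<close> lie in all the ranges. Writing \<open>y = T x\<close> gives
  \<open>\<bar>(v, y)\<bar>\<^sup>2 \<le> \<parallel>x\<parallel>\<^sup>2 \<parallel>T v\<parallel>\<^sup>2 = \<parallel>x\<parallel>\<^sup>2 ((A - M) v, v)\<close>, so the rank-one operator
  \<open>v \<mapsto> (v, y) y\<close> is below a multiple of \<open>A - M\<close>. For a finite family one multiple \<open>K\<close> serves
  all \<open>A\<close>, and \<open>M\<close> plus \<open>1/K\<close> times the rank-one operator is a strictly larger lower bound.

  Both parts use that \<open>op_sqrt\<close> really is a self-adjoint operator squaring to its argument, that
  is, the existence and uniqueness of positive square roots, which is proved along the way.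
  Since the real inner product is the real part of the complex one, most arguments run in the
  underlying real inner product space; complex linearity matters only for membership in
  \<open>selfadjoint_ops\<close> and for the rank-one operator.
\<close>

section \<open>Symmetric operators on real inner product spaces\<close>

lemma nonneg_quadratic_discriminant:
  fixes a b c :: real
  assumes "c \<ge> 0" and nonneg: "\<And>t. 0 \<le> a + 2 * t * b + t\<^sup>2 * c"
  shows "b\<^sup>2 \<le> a * c"
proof (cases "c = 0")
  case True
  have "b = 0"
  proof (rule ccontr)
    assume "b \<noteq> 0"
    then show False
      using nonneg[of "- (a + 1) / (2 * b)"] True by (simp add: field_simps)
  qed
  then show ?thesis using True by simp
next
  case False
  then have "c > 0" using \<open>c \<ge> 0\<close> by simp
  then show ?thesis
    using nonneg[of "- b / c"] by (simp add: field_simps power2_eq_square)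
qed

text \<open>The form is nonnegative along the line \<open>u + t v\<close>, so the quadratic in \<open>t\<close> has no two real roots.\<close>

lemma Cauchy_Schwarz_nonneg_form:
  fixes S :: "'a::real_inner \<Rightarrow>\<^sub>L 'a"
  assumes sym: "\<And>u v. inner (S u) v = inner u (S v)"
    and nonneg: "\<And>u. 0 \<le> inner (S u) u"
  shows "(inner (S u) v)\<^sup>2 \<le> inner (S u) u * inner (S v) v"
proof (rule nonneg_quadratic_discriminant)
  show "0 \<le> inner (S v) v" by (rule nonneg)
  fix t :: real
  have vu: "inner (S v) u = inner (S u) v"
    using sym[of v u] by (simp add: inner_commute)
  have "0 \<le> inner (S (u + t *\<^sub>R v)) (u + t *\<^sub>R v)" by (rule nonneg)
  also have "\<dots> = inner (S u) u + 2 * t * inner (S u) v + t\<^sup>2 * inner (S v) v"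
    using vu by (simp add: blinfun.add_right blinfun.scaleR_right inner_add_left inner_add_right
        power2_eq_square algebra_simps)
  finally show "0 \<le> inner (S u) u + 2 * t * inner (S u) v + t\<^sup>2 * inner (S v) v" .
qed

lemma kernel_of_nonneg_form:
  fixes S :: "'a::real_inner \<Rightarrow>\<^sub>L 'a"
  assumes "\<And>u v. inner (S u) v = inner u (S v)" and "\<And>u. 0 \<le> inner (S u) u"
    and "inner (S u) u = 0"
  shows "S u = 0"
  using Cauchy_Schwarz_nonneg_form[OF assms(1,2), of u "S u"] assms(3) by simp

text \<open>
  The form controls the norm: Cauchy-Schwarz with \<open>v = S u\<close> gives
  \<open>\<parallel>S u\<parallel>\<^sup>4 \<le> (S u, u) (S S u, S u) \<le> \<parallel>u\<parallel>\<^sup>2 \<parallel>S u\<parallel>\<^sup>2\<close>.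
\<close>

lemma norm_nonneg_contraction:
  fixes S :: "'a::real_inner \<Rightarrow>\<^sub>L 'a"
  assumes sym: "\<And>u v. inner (S u) v = inner u (S v)"
    and nonneg: "\<And>u. 0 \<le> inner (S u) u"
    and le: "\<And>u. inner (S u) u \<le> inner u u"
  shows "norm S \<le> 1"
proof (rule norm_blinfun_bound)
  fix u
  have "(inner (S u) (S u))\<^sup>2 \<le> inner (S u) u * inner (S (S u)) (S u)"
    by (rule Cauchy_Schwarz_nonneg_form[OF sym nonneg])
  also have "\<dots> \<le> inner u u * inner (S u) (S u)"
    by (intro mult_mono le nonneg inner_ge_zero)
  finally have "inner (S u) (S u) * inner (S u) (S u) \<le> inner u u * inner (S u) (S u)"
    by (simp add: power2_eq_square)
  then have "inner (S u) (S u) \<le> inner u u"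
    by (cases "S u = 0") (auto simp: mult_le_cancel_right)
  then show "norm (S u) \<le> 1 * norm u"
    by (simp add: norm_le)
qed simp

text \<open>
  The hypothesis makes \<open>T v \<mapsto> (y, v)\<close> a bounded functional on the range of \<open>T\<close>; its Riesz
  representative \<open>z\<close> in the closure of that range satisfies \<open>(z, T v) = (y, v)\<close>, whence
  \<open>T z = y\<close> by symmetry. The representative is found by minimising
  \<open>f v = \<parallel>T v\<parallel>\<^sup>2 - 2 (y, v)\<close>: along a minimising sequence the images under \<open>T\<close> form a Cauchy
  sequence by the parallelogram law, although the sequence itself need not converge.
\<close>

lemma in_range_symmetric_if_bounded:
  fixes T :: "'a::{real_inner,complete_space} \<Rightarrow>\<^sub>L 'a"
  assumes sym: "\<And>u v. inner (T u) v = inner u (T v)"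
    and bound: "\<And>v. inner y v \<le> C * norm (T v)"
  shows "y \<in> range (blinfun_apply T)"
proof -
  define f where "f v = (norm (T v))\<^sup>2 - 2 * inner y v" for v
  define m where "m = Inf (range f)"
  have f_lower: "- C\<^sup>2 \<le> f v" for v
  proof -
    have "0 \<le> (norm (T v) - C)\<^sup>2" by simp
    then have "2 * (C * norm (T v)) \<le> (norm (T v))\<^sup>2 + C\<^sup>2"
      by (simp add: power2_eq_square algebra_simps)
    then show ?thesis using bound[of v] unfolding f_def by linarith
  qed
  have bdd: "bdd_below (range f)"
    using f_lower by (auto intro!: bdd_belowI)
  have m_le: "m \<le> f v" for v
    unfolding m_def by (rule cInf_lower[OF _ bdd]) simp
  have "\<exists>x. f x < m + inverse (real (Suc n))" for n
    using cInf_lessD[of "range f" "m + inverse (real (Suc n))"] by (auto simp: m_def)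
  then obtain x where x: "\<And>n. f (x n) < m + inverse (real (Suc n))" by metis
  have f_line: "f (u + t *\<^sub>R v) = f u + 2 * t * (inner (T u) (T v) - inner y v) + t\<^sup>2 * (norm (T v))\<^sup>2"
    for u v t
    unfolding f_def power2_norm_eq_inner
    by (simp add: blinfun.add_right blinfun.scaleR_right inner_add_left inner_add_right
        inner_commute power2_eq_square algebra_simps)
  have near_min: "(norm (T u - T v))\<^sup>2 \<le> 2 * (f u - m) + 2 * (f v - m)" for u v
  proof -
    define w where "w = (1/2) *\<^sub>R (u + v)"
    have "2 * f u + 2 * f v = 4 * f w + (norm (T u - T v))\<^sup>2"
      unfolding f_def w_def power2_norm_eq_inner
      by (simp add: blinfun.add_right blinfun.scaleR_right inner_add_left inner_add_right
          inner_diff_left inner_diff_right inner_commute field_simps)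
    moreover have "4 * m \<le> 4 * f w" using m_le[of w] by simp
    ultimately show ?thesis by (simp add: right_diff_distrib)
  qed
  have "Cauchy (\<lambda>n. T (x n))"
  proof (rule metric_CauchyI)
    fix e :: real assume "e > 0"
    then obtain N where N: "inverse (real (Suc N)) < e\<^sup>2 / 4"
      using reals_Archimedean[of "e\<^sup>2 / 4"] by auto
    have "dist (T (x i)) (T (x j)) < e" if "i \<ge> N" "j \<ge> N" for i j
    proof -
      have "f (x k) - m < e\<^sup>2 / 4" if "k \<ge> N" for k
      proof -
        have "inverse (real (Suc k)) \<le> inverse (real (Suc N))"
          using that by (intro le_imp_inverse_le) auto
        then show ?thesis using x[of k] N by linarith
      qed
      then have "2 * (f (x i) - m) + 2 * (f (x j) - m) < 2 * (e\<^sup>2 / 4) + 2 * (e\<^sup>2 / 4)"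
        using that by (intro add_strict_mono mult_strict_left_mono) auto
      then have "(norm (T (x i) - T (x j)))\<^sup>2 < e\<^sup>2"
        using near_min[of "x i" "x j"] by simp
      then show ?thesis
        using \<open>e > 0\<close> by (simp add: dist_norm power_less_imp_less_base)
    qed
    then show "\<exists>N. \<forall>i\<ge>N. \<forall>j\<ge>N. dist (T (x i)) (T (x j)) < e" by blast
  qed
  then obtain z where z: "(\<lambda>n. T (x n)) \<longlonglongrightarrow> z"
    using Cauchy_convergent_iff convergent_def by blast
  have "(\<lambda>n. f (x n)) \<longlonglongrightarrow> m"
  proof (rule tendsto_sandwich)
    show "\<forall>\<^sub>F n in sequentially. m \<le> f (x n)" by (simp add: m_le)
    show "\<forall>\<^sub>F n in sequentially. f (x n) \<le> m + inverse (real (Suc n))"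
      using x by (simp add: less_imp_le)
    show "(\<lambda>n. m + inverse (real (Suc n))) \<longlonglongrightarrow> m"
      using LIMSEQ_inverse_real_of_nat_add by simp
  qed simp
  then have gap: "(\<lambda>n. (f (x n) - m) * (norm (T v))\<^sup>2) \<longlonglongrightarrow> (m - m) * (norm (T v))\<^sup>2" for v
    by (intro tendsto_intros)
  \<comment> \<open>Near-minimality of \<open>x n\<close> bounds the slope of \<open>f\<close> there in every direction \<open>v\<close>; in the
    limit this becomes the Euler-Lagrange equation.\<close>
  have weak: "inner z (T v) = inner y v" for v
  proof -
    have "(inner (T (x n)) (T v) - inner y v)\<^sup>2 \<le> (f (x n) - m) * (norm (T v))\<^sup>2" for n
    proof (rule nonneg_quadratic_discriminant)
      fix t
      show "0 \<le> f (x n) - m + 2 * t * (inner (T (x n)) (T v) - inner y v) + t\<^sup>2 * (norm (T v))\<^sup>2"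
        using m_le[of "x n + t *\<^sub>R v"] f_line[of "x n" t v] by linarith
    qed simp
    moreover have "(\<lambda>n. (inner (T (x n)) (T v) - inner y v)\<^sup>2) \<longlonglongrightarrow> (inner z (T v) - inner y v)\<^sup>2"
      by (intro tendsto_intros z)
    ultimately have "(inner z (T v) - inner y v)\<^sup>2 \<le> (m - m) * (norm (T v))\<^sup>2"
      using gap[of v] by (intro LIMSEQ_le) auto
    then show ?thesis by simp
  qed
  have "inner (T z - y) v = 0" for v
    using weak[of v] sym[of z v] by (simp add: inner_diff_left)
  then have "T z = y"
    by (metis inner_eq_zero_iff right_minus_eq)
  then show ?thesis by blast
qed

section \<open>Self-adjoint operators\<close>

instance chilbert_space \<subseteq> banach ..

lemma cinner_scaleC_right: "cinner x (c *\<^sub>C y) = cnj c * cinner (x::'a::complex_inner) y"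
  by (metis cinner_commute cinner_scaleC_left complex_cnj_mult)

text \<open>Recovers the complex inner product from the real one, so that symmetry and limits need only be
  treated for the latter.\<close>

lemma cinner_eq_inner: "cinner x y = Complex (inner x y) (inner (x::'a::complex_inner) (\<i> *\<^sub>C y))"
  by (simp add: complex_eq_iff inner_eq_Re_cinner cinner_scaleC_right)

lemma norm_scaleC: "norm (c *\<^sub>C x) = cmod c * norm (x::'a::complex_inner)"
proof -
  have "complex_of_real ((norm (c *\<^sub>C x))\<^sup>2) = (c * cnj c) * cinner x x"
    by (metis cinner_scaleC_left cinner_scaleC_right cinner_self mult.assoc)
  also have "\<dots> = complex_of_real ((cmod c * norm x)\<^sup>2)"
    by (metis cinner_self complex_norm_square of_real_mult of_real_power power_mult_distrib)
  finally have "(norm (c *\<^sub>C x))\<^sup>2 = (cmod c * norm x)\<^sup>2"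
    using of_real_eq_iff by blast
  then show ?thesis by (simp add: power2_eq_iff_nonneg)
qed

text \<open>Rotating \<open>x\<close> by the conjugate of \<open>cinner x y\<close> makes the product real and reduces this to the
  real Cauchy-Schwarz inequality.\<close>

lemma norm_cinner_le: "cmod (cinner x y) \<le> norm x * norm (y::'a::complex_inner)"
proof (cases "cinner x y = 0")
  case False
  let ?z = "cinner x y"
  have "(cmod ?z)\<^sup>2 = Re (cnj ?z * ?z)"
    by (metis Re_complex_of_real complex_norm_square mult.commute)
  also have "\<dots> = inner (cnj ?z *\<^sub>C x) y"
    by (simp add: inner_eq_Re_cinner cinner_scaleC_left)
  also have "\<dots> \<le> cmod ?z * norm x * norm y"
    using norm_cauchy_schwarz[of "cnj ?z *\<^sub>C x" y] by (simp add: norm_scaleC)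
  finally show ?thesis using False by (simp add: power2_eq_square mult.assoc)
qed simp

lemma selfadjoint_inner:
  assumes "S \<in> selfadjoint_ops"
  shows "inner (blinfun_apply S u) v = inner u (blinfun_apply S v)"
  using assms by (simp add: selfadjoint_ops_def inner_eq_Re_cinner)

lemma loewner_le_iff: "S \<preceq> T \<longleftrightarrow> (\<forall>u. inner (blinfun_apply S u) u \<le> inner (blinfun_apply T u) u)"
  by (simp add: loewner_le_def inner_eq_Re_cinner)

lemma selfadjoint_ops_iff:
  "S \<in> selfadjoint_ops \<longleftrightarrow> (\<forall>c u. blinfun_apply S (c *\<^sub>C u) = c *\<^sub>C blinfun_apply S u) \<and>
    (\<forall>u v. inner (blinfun_apply S u) v = inner u (blinfun_apply S v))"
    (is "_ \<longleftrightarrow> ?linear \<and> ?symmetric")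
proof
  assume "S \<in> selfadjoint_ops"
  then show "?linear \<and> ?symmetric"
    using selfadjoint_inner[of S] by (simp add: selfadjoint_ops_def)
next
  assume "?linear \<and> ?symmetric"
  then show "S \<in> selfadjoint_ops"
    by (simp add: selfadjoint_ops_def cinner_eq_inner)
qed

lemma bounded_linear_scaleC: "bounded_linear (\<lambda>x. c *\<^sub>C (x::'a::complex_inner))"
proof (rule bounded_linear_intro)
  show "c *\<^sub>C r *\<^sub>R x = r *\<^sub>R c *\<^sub>C (x::'a)" for r x
    by (simp add: scaleR_scaleC scaleC_scaleC mult.commute)
  show "norm (c *\<^sub>C x) \<le> norm x * cmod c" for x :: 'a
    by (simp add: norm_scaleC mult.commute)
qed (rule scaleC_add_right)

lemma selfadjoint_id: "id_blinfun \<in> selfadjoint_ops"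
  by (simp add: selfadjoint_ops_iff)

lemma selfadjoint_zero: "0 \<in> selfadjoint_ops"
  by (simp add: selfadjoint_ops_iff linear_0[OF bounded_linear.linear[OF bounded_linear_scaleC]])

lemma selfadjoint_add:
  assumes "S \<in> selfadjoint_ops" "T \<in> selfadjoint_ops"
  shows "S + T \<in> selfadjoint_ops"
  using assms by (simp add: selfadjoint_ops_iff blinfun.add_left scaleC_add_right
      inner_add_left inner_add_right)

lemma selfadjoint_scaleR:
  assumes "S \<in> selfadjoint_ops"
  shows "r *\<^sub>R S \<in> selfadjoint_ops"
  using assms by (simp add: selfadjoint_ops_iff blinfun.scaleR_left
      linear_scale[OF bounded_linear.linear[OF bounded_linear_scaleC]])

lemma selfadjoint_diff:
  assumes "S \<in> selfadjoint_ops" "T \<in> selfadjoint_ops"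
  shows "S - T \<in> selfadjoint_ops"
  using selfadjoint_add[OF assms(1) selfadjoint_scaleR[OF assms(2), of "-1"]] by simp

lemma selfadjoint_square:
  assumes "S \<in> selfadjoint_ops"
  shows "S o\<^sub>L S \<in> selfadjoint_ops"
  using assms by (simp add: selfadjoint_ops_iff)

lemma selfadjoint_limit:
  assumes X: "\<And>n. X n \<in> selfadjoint_ops" and lim: "X \<longlonglongrightarrow> S"
  shows "S \<in> selfadjoint_ops"
proof -
  have app: "(\<lambda>n. blinfun_apply (X n) u) \<longlonglongrightarrow> blinfun_apply S u" for u
    by (intro tendsto_intros lim)
  have "blinfun_apply S (c *\<^sub>C u) = c *\<^sub>C blinfun_apply S u" for c u
  proof (rule LIMSEQ_unique)
    show "(\<lambda>n. blinfun_apply (X n) (c *\<^sub>C u)) \<longlonglongrightarrow> blinfun_apply S (c *\<^sub>C u)"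
      by (rule app)
    show "(\<lambda>n. blinfun_apply (X n) (c *\<^sub>C u)) \<longlonglongrightarrow> c *\<^sub>C blinfun_apply S u"
      using bounded_linear.tendsto[OF bounded_linear_scaleC app] X
      by (simp add: selfadjoint_ops_iff)
  qed
  moreover have "inner (blinfun_apply S u) v = inner u (blinfun_apply S v)" for u v
  proof (rule LIMSEQ_unique)
    show "(\<lambda>n. inner (blinfun_apply (X n) u) v) \<longlonglongrightarrow> inner (blinfun_apply S u) v"
      by (intro tendsto_intros app)
    have "(\<lambda>n. inner u (blinfun_apply (X n) v)) \<longlonglongrightarrow> inner u (blinfun_apply S v)"
      by (intro tendsto_intros app)
    then show "(\<lambda>n. inner (blinfun_apply (X n) u) v) \<longlonglongrightarrow> inner u (blinfun_apply S v)"
      using X by (simp add: selfadjoint_ops_iff)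
  qed
  ultimately show ?thesis by (simp add: selfadjoint_ops_iff)
qed

section \<open>The positive square root\<close>

lemma blinfun_compose_assoc: "(A o\<^sub>L B) o\<^sub>L C = A o\<^sub>L (B o\<^sub>L C)"
  by (rule blinfun_eqI) simp

lemma blinfun_compose_id: "A o\<^sub>L id_blinfun = A" "id_blinfun o\<^sub>L A = A"
  by (rule blinfun_eqI, simp)+

text \<open>
  For \<open>0 \<le> S \<le> 1\<close> put \<open>R = 1 - S\<close>. A solution of \<open>X = (R + X\<^sup>2) / 2\<close> satisfies
  \<open>(1 - X)\<^sup>2 = 1 - R = S\<close>, and \<open>1 - X\<close> is positive when \<open>\<parallel>X\<parallel> \<le> 1\<close>. The solution is the limit
  of the fixed-point iteration started at \<open>0\<close>. Its map is not a strict contraction on the unit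
  ball, so convergence is obtained by comparison with the same iteration for the number \<open>1\<close>,
  which increases and stays below \<open>1\<close>.
\<close>

primrec sqrt_iter :: "('a::real_normed_vector \<Rightarrow>\<^sub>L 'a) \<Rightarrow> nat \<Rightarrow> ('a \<Rightarrow>\<^sub>L 'a)"
  where
    "sqrt_iter R 0 = 0"
  | "sqrt_iter R (Suc n) = (1/2) *\<^sub>R (R + (sqrt_iter R n o\<^sub>L sqrt_iter R n))"

primrec sqrt_majorant :: "nat \<Rightarrow> real"
  where
    "sqrt_majorant 0 = 0"
  | "sqrt_majorant (Suc n) = (1 + (sqrt_majorant n)\<^sup>2) / 2"

lemma sqrt_majorant_bounds: "0 \<le> sqrt_majorant n \<and> sqrt_majorant n \<le> 1"
  by (induction n) (auto simp: power_le_one)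

lemma sqrt_majorant_mono: "sqrt_majorant n \<le> sqrt_majorant (Suc n)"
proof -
  have "0 \<le> (1 - sqrt_majorant n)\<^sup>2" by simp
  then show ?thesis by (simp add: power2_eq_square algebra_simps)
qed

lemma norm_sqrt_iter_le:
  assumes "norm R \<le> 1"
  shows "norm (sqrt_iter R n) \<le> sqrt_majorant n"
proof (induction n)
  case (Suc n)
  have "norm (R + (sqrt_iter R n o\<^sub>L sqrt_iter R n))
      \<le> norm R + norm (sqrt_iter R n) * norm (sqrt_iter R n)"
    by (rule order_trans[OF norm_triangle_ineq add_left_mono[OF norm_blinfun_compose]])
  also have "\<dots> \<le> 1 + sqrt_majorant n * sqrt_majorant n"
    using Suc assms by (intro add_mono mult_mono) (auto simp: sqrt_majorant_bounds)
  finally show ?case by (simp add: power2_eq_square)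
qed simp

text \<open>
  The increments telescope under the majorant because \<open>Y\<^sup>2 - X\<^sup>2 = Y (Y - X) + (Y - X) X\<close>
  mirrors \<open>t\<^sup>2 - s\<^sup>2 = t (t - s) + (t - s) s\<close>.
\<close>

lemma norm_sqrt_iter_diff_le:
  assumes "norm R \<le> 1"
  shows "norm (sqrt_iter R (Suc n) - sqrt_iter R n) \<le> sqrt_majorant (Suc n) - sqrt_majorant n"
proof (induction n)
  case 0
  then show ?case using assms by simp
next
  case (Suc n)
  let ?X = "sqrt_iter R n" and ?Y = "sqrt_iter R (Suc n)"
  let ?s = "sqrt_majorant n" and ?t = "sqrt_majorant (Suc n)"
  have "sqrt_iter R (Suc (Suc n)) - ?Y
      = (1/2) *\<^sub>R (R + (?Y o\<^sub>L ?Y)) - (1/2) *\<^sub>R (R + (?X o\<^sub>L ?X))"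
    by simp
  also have "\<dots> = (1/2) *\<^sub>R ((?Y o\<^sub>L (?Y - ?X)) + ((?Y - ?X) o\<^sub>L ?X))"
    by (simp only: bounded_bilinear.diff_left[OF bounded_bilinear_blinfun_compose]
        bounded_bilinear.diff_right[OF bounded_bilinear_blinfun_compose] scaleR_diff_right[symmetric])
      simp
  finally have eq: "sqrt_iter R (Suc (Suc n)) - ?Y
      = (1/2) *\<^sub>R ((?Y o\<^sub>L (?Y - ?X)) + ((?Y - ?X) o\<^sub>L ?X))" .
  have "norm ((?Y o\<^sub>L (?Y - ?X)) + ((?Y - ?X) o\<^sub>L ?X))
      \<le> norm ?Y * norm (?Y - ?X) + norm (?Y - ?X) * norm ?X"
    by (rule order_trans[OF norm_triangle_ineq add_mono[OF norm_blinfun_compose norm_blinfun_compose]])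
  also have "\<dots> \<le> ?t * (?t - ?s) + (?t - ?s) * ?s"
    using Suc norm_sqrt_iter_le[OF assms] sqrt_majorant_mono[of n] sqrt_majorant_bounds
    by (intro add_mono mult_mono) (auto simp del: sqrt_majorant.simps sqrt_iter.simps)
  also have "\<dots> = ?t\<^sup>2 - ?s\<^sup>2"
    by (simp only: power2_eq_square algebra_simps)
  also have "\<dots> = 2 * (sqrt_majorant (Suc (Suc n)) - ?t)"
    by (simp add: field_simps)
  finally show ?case unfolding eq by (simp del: sqrt_majorant.simps sqrt_iter.simps)
qed

lemma sqrt_iter_converges:
  fixes R :: "'a::banach \<Rightarrow>\<^sub>L 'a"
  assumes "norm R \<le> 1"
  obtains X where "sqrt_iter R \<longlonglongrightarrow> X" "norm X \<le> 1" "X = (1/2) *\<^sub>R (R + (X o\<^sub>L X))"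
proof -
  have "incseq sqrt_majorant"
    using sqrt_majorant_mono by (rule incseq_SucI)
  then obtain l where "sqrt_majorant \<longlonglongrightarrow> l"
    using incseq_convergent[of sqrt_majorant 1] sqrt_majorant_bounds by blast
  then have "summable (\<lambda>n. sqrt_majorant (Suc n) - sqrt_majorant n)"
    by (rule telescope_summable)
  then have "summable (\<lambda>n. sqrt_iter R (Suc n) - sqrt_iter R n)"
    by (rule summable_comparison_test'[where N = 0]) (rule norm_sqrt_iter_diff_le[OF assms])
  then have "convergent (\<lambda>n. \<Sum>k<n. sqrt_iter R (Suc k) - sqrt_iter R k)"
    by (simp add: summable_iff_convergent)
  then have "convergent (sqrt_iter R)"
    by (subst (asm) sum_lessThan_telescope) simp
  then obtain X where X: "sqrt_iter R \<longlonglongrightarrow> X"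
    by (auto simp: convergent_def)
  have "norm (sqrt_iter R n) \<le> 1" for n
    using norm_sqrt_iter_le[OF assms, of n] sqrt_majorant_bounds[of n] by linarith
  then have "norm X \<le> 1"
    by (intro Lim_norm_ubound[OF _ X]) auto
  moreover have "X = (1/2) *\<^sub>R (R + (X o\<^sub>L X))"
  proof (rule LIMSEQ_unique)
    show "(\<lambda>n. sqrt_iter R (Suc n)) \<longlonglongrightarrow> X"
      using X by (rule LIMSEQ_Suc)
    show "(\<lambda>n. sqrt_iter R (Suc n)) \<longlonglongrightarrow> (1/2) *\<^sub>R (R + (X o\<^sub>L X))"
      unfolding sqrt_iter.simps
      by (intro tendsto_intros X bounded_bilinear.tendsto[OF bounded_bilinear_blinfun_compose])
  qed
  ultimately show ?thesis using X that by blast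
qed

text \<open>
  The last property, that \<open>T\<close> commutes with everything commuting with \<open>S\<close>, passes from the iterates,
  which are polynomials in \<open>R\<close>, to the limit. It is what makes uniqueness provable.
\<close>

lemma positive_square_root_exists:
  fixes S :: "'a::chilbert_space \<Rightarrow>\<^sub>L 'a"
  assumes S: "S \<in> selfadjoint_ops" and pos: "0 \<preceq> S"
  obtains T where "T \<in> selfadjoint_ops" "0 \<preceq> T" "T o\<^sub>L T = S"
    "\<And>P. P o\<^sub>L S = S o\<^sub>L P \<Longrightarrow> P o\<^sub>L T = T o\<^sub>L P"
proof -
  interpret C: bounded_bilinear "blinfun_compose :: ('a \<Rightarrow>\<^sub>L 'a) \<Rightarrow> ('a \<Rightarrow>\<^sub>L 'a) \<Rightarrow> ('a \<Rightarrow>\<^sub>L 'a)"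
    by (rule bounded_bilinear_blinfun_compose)
  \<comment> \<open>Scaling by \<open>c\<close> brings \<open>S\<close> below the identity; the summand \<open>1\<close> keeps \<open>c\<close> positive for \<open>S = 0\<close>.\<close>
  define c where "c = norm S + 1"
  have "c > 0" by (simp add: c_def add_nonneg_pos)
  define R where "R = id_blinfun - (1/c) *\<^sub>R S"
  have R: "R \<in> selfadjoint_ops"
    unfolding R_def by (intro selfadjoint_diff selfadjoint_id selfadjoint_scaleR S)
  have R_form: "inner (R u) u = inner u u - inner (S u) u / c" for u
    by (simp add: R_def blinfun.diff_left blinfun.scaleR_left inner_diff_left)
  have S_form: "0 \<le> inner (S u) u" for u
    using pos by (simp add: loewner_le_iff)
  have "norm R \<le> 1"
  proof (rule norm_nonneg_contraction)
    show "inner (R u) v = inner u (R v)" for u v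
      by (rule selfadjoint_inner[OF R])
    show "inner (R u) u \<le> inner u u" for u
      using S_form[of u] \<open>c > 0\<close> by (simp add: R_form)
    show "0 \<le> inner (R u) u" for u
    proof -
      have "inner (S u) u \<le> norm (S u) * norm u" by (rule norm_cauchy_schwarz)
      also have "\<dots> \<le> (norm S * norm u) * norm u"
        by (intro mult_right_mono norm_blinfun) simp
      also have "\<dots> \<le> c * inner u u"
        by (simp add: c_def algebra_simps dot_square_norm power2_eq_square)
      finally show ?thesis using \<open>c > 0\<close> by (simp add: R_form field_simps)
    qed
  qed
  then obtain X where lim: "sqrt_iter R \<longlonglongrightarrow> X" and X1: "norm X \<le> 1"
    and fixpoint: "X = (1/2) *\<^sub>R (R + (X o\<^sub>L X))"
    by (rule sqrt_iter_converges)
  have iter_sa: "sqrt_iter R n \<in> selfadjoint_ops" for n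
    by (induction n) (simp_all add: selfadjoint_zero selfadjoint_scaleR selfadjoint_add
        selfadjoint_square R)
  have X: "X \<in> selfadjoint_ops"
    by (rule selfadjoint_limit[OF iter_sa lim])
  define T where "T = sqrt c *\<^sub>R (id_blinfun - X)"
  have "T \<in> selfadjoint_ops"
    unfolding T_def by (intro selfadjoint_diff selfadjoint_id selfadjoint_scaleR X)
  moreover have "0 \<preceq> T"
  proof -
    have "0 \<le> inner (T u) u" for u
    proof -
      have "inner (X u) u \<le> norm (X u) * norm u" by (rule norm_cauchy_schwarz)
      also have "\<dots> \<le> (norm X * norm u) * norm u"
        by (intro mult_right_mono norm_blinfun) simp
      also have "\<dots> \<le> (1 * norm u) * norm u"
        by (intro mult_right_mono X1) simp_all
      finally have "inner (X u) u \<le> inner u u"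
        by (simp add: dot_square_norm power2_eq_square)
      then show ?thesis
        using \<open>c > 0\<close> by (simp add: T_def blinfun.scaleR_left blinfun.diff_left inner_diff_left)
    qed
    then show ?thesis by (simp add: loewner_le_iff)
  qed
  moreover have "T o\<^sub>L T = S"
  proof -
    have "2 *\<^sub>R X = R + (X o\<^sub>L X)"
      using arg_cong[OF fixpoint, of "scaleR 2"] by simp
    then have "X o\<^sub>L X = 2 *\<^sub>R X - R" by simp
    have "(id_blinfun - X) o\<^sub>L (id_blinfun - X) = id_blinfun - X - X + (X o\<^sub>L X)"
      by (simp add: C.diff_left C.diff_right blinfun_compose_id)
    also have "\<dots> = (1/c) *\<^sub>R S"
      unfolding \<open>X o\<^sub>L X = 2 *\<^sub>R X - R\<close> by (simp add: R_def scaleR_2)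
    finally show ?thesis
      using \<open>c > 0\<close> by (simp add: T_def C.scaleR_left C.scaleR_right)
  qed
  moreover have "P o\<^sub>L T = T o\<^sub>L P" if "P o\<^sub>L S = S o\<^sub>L P" for P
  proof -
    have PR: "P o\<^sub>L R = R o\<^sub>L P"
      using that by (simp add: R_def C.diff_left C.diff_right C.scaleR_left C.scaleR_right
          blinfun_compose_id)
    have "P o\<^sub>L sqrt_iter R n = sqrt_iter R n o\<^sub>L P" for n
    proof (induction n)
      case 0
      then show ?case by (simp add: C.zero_left C.zero_right)
    next
      case (Suc n)
      have "P o\<^sub>L (sqrt_iter R n o\<^sub>L sqrt_iter R n) = (sqrt_iter R n o\<^sub>L sqrt_iter R n) o\<^sub>L P"
        using Suc by (metis blinfun_compose_assoc)
      then show ?case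
        using PR by (simp add: C.scaleR_left C.scaleR_right C.add_left C.add_right)
    qed
    then have "P o\<^sub>L X = X o\<^sub>L P"
      using C.tendsto[OF tendsto_const[of P] lim] C.tendsto[OF lim tendsto_const[of P]]
      by (auto intro: LIMSEQ_unique)
    then show ?thesis
      by (simp add: T_def C.diff_left C.diff_right C.scaleR_left C.scaleR_right
          blinfun_compose_id)
  qed
  ultimately show ?thesis using that by blast
qed

text \<open>
  For commuting \<open>T\<close> and \<open>P\<close>, the vector \<open>w = (T - P) u\<close> satisfies
  \<open>(T + P) w = (T\<^sup>2 - P\<^sup>2) u = 0\<close>. The forms of \<open>T\<close> and \<open>P\<close> are nonnegative, so both vanish
  at \<open>w\<close>; hence \<open>T w = P w = 0\<close> and \<open>(w, w) = (u, (T - P) w) = 0\<close>.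
\<close>

lemma positive_square_root_unique:
  fixes T P :: "'a::complex_inner \<Rightarrow>\<^sub>L 'a"
  assumes T: "T \<in> selfadjoint_ops" "0 \<preceq> T" and P: "P \<in> selfadjoint_ops" "0 \<preceq> P"
    and squares: "T o\<^sub>L T = P o\<^sub>L P" and comm: "P o\<^sub>L T = T o\<^sub>L P"
  shows "P = T"
proof (rule blinfun_eqI)
  fix u
  define w where "w = T u - P u"
  have "T w + P w = (T o\<^sub>L T) u - (P o\<^sub>L P) u + ((P o\<^sub>L T) u - (T o\<^sub>L P) u)"
    by (simp add: w_def blinfun.diff_right)
  then have "T w + P w = 0"
    unfolding squares comm by simp
  then have "inner (T w) w + inner (P w) w = 0"
    by (metis inner_add_left inner_zero_left)
  moreover have pos: "0 \<le> inner (T v) v" "0 \<le> inner (P v) v" for v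
    using T(2) P(2) by (simp_all add: loewner_le_iff)
  ultimately have "inner (T w) w = 0" "inner (P w) w = 0"
    by (smt (verit))+
  then have "T w = 0" "P w = 0"
    using kernel_of_nonneg_form[OF selfadjoint_inner[OF T(1)] pos(1)]
      kernel_of_nonneg_form[OF selfadjoint_inner[OF P(1)] pos(2)] by blast+
  then have "inner w w = 0"
    using selfadjoint_inner[OF T(1), of u w] selfadjoint_inner[OF P(1), of u w]
    by (simp add: w_def inner_diff_left)
  then show "P u = T u" by (simp add: w_def)
qed

text \<open>
  Any positive root \<open>P\<close> of \<open>S\<close> commutes with \<open>S = P\<^sup>2\<close>, hence with the constructed root \<open>T\<close>, so
  the uniqueness lemma for commuting roots applies to every candidate.
\<close>

lemma op_sqrt_props:
  fixes S :: "'a::chilbert_space \<Rightarrow>\<^sub>L 'a"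
  assumes S: "S \<in> selfadjoint_ops" "0 \<preceq> S"
  shows "op_sqrt S \<in> selfadjoint_ops" "op_sqrt S o\<^sub>L op_sqrt S = S"
proof -
  obtain T where T: "T \<in> selfadjoint_ops" "0 \<preceq> T" "T o\<^sub>L T = S"
    and comm: "\<And>P. P o\<^sub>L S = S o\<^sub>L P \<Longrightarrow> P o\<^sub>L T = T o\<^sub>L P"
    using positive_square_root_exists[OF S] by blast
  have "P = T" if P: "P \<in> selfadjoint_ops \<and> 0 \<preceq> P \<and> P o\<^sub>L P = S" for P
  proof (rule positive_square_root_unique)
    show "P o\<^sub>L T = T o\<^sub>L P"
      using P by (metis comm blinfun_compose_assoc)
    show "T o\<^sub>L T = P o\<^sub>L P"
      using T(3) P by metis
  qed (use T(1,2) P in blast)+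
  then have "op_sqrt S = T"
    unfolding op_sqrt_def using T(1-3) by (intro the_equality) blast+
  with T(1,3) show "op_sqrt S \<in> selfadjoint_ops" "op_sqrt S o\<^sub>L op_sqrt S = S" by simp_all
qed

lemma norm_op_sqrt:
  fixes S :: "'a::chilbert_space \<Rightarrow>\<^sub>L 'a"
  assumes "S \<in> selfadjoint_ops" "0 \<preceq> S"
  shows "(norm (blinfun_apply (op_sqrt S) u))\<^sup>2 = inner (blinfun_apply S u) u"
proof -
  have "(norm (op_sqrt S u))\<^sup>2 = inner ((op_sqrt S o\<^sub>L op_sqrt S) u) u"
    using selfadjoint_inner[OF op_sqrt_props(1)[OF assms]]
    by (simp add: power2_norm_eq_inner)
  then show ?thesis
    by (simp only: op_sqrt_props(2)[OF assms])
qed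

section \<open>Ranges of square roots and rank-one operators\<close>

text \<open>
  A form of Douglas' range inclusion: with \<open>T\<close> the root of \<open>S\<close>, Cauchy-Schwarz for \<open>D\<close> yields
  \<open>(D u, v)\<^sup>2 \<le> (D u, u) (D v, v) \<le> (D u, u) \<parallel>T v\<parallel>\<^sup>2\<close>. Working with \<open>D\<close> itself suffices to detect
  \<open>D = 0\<close>, and avoids its square root.
\<close>

lemma range_le_range_op_sqrt:
  fixes D S :: "'a::chilbert_space \<Rightarrow>\<^sub>L 'a"
  assumes D: "D \<in> selfadjoint_ops" "0 \<preceq> D" and S: "S \<in> selfadjoint_ops" and "D \<preceq> S"
  shows "range (blinfun_apply D) \<subseteq> range (blinfun_apply (op_sqrt S))"
proof safe
  fix u
  have D_form: "0 \<le> inner (D v) v" for v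
    using D(2) by (simp add: loewner_le_iff)
  have S_pos: "0 \<preceq> S"
    using D(2) \<open>D \<preceq> S\<close> order_trans unfolding loewner_le_iff by blast
  show "D u \<in> range (op_sqrt S)"
  proof (rule in_range_symmetric_if_bounded)
    show "inner (op_sqrt S x) v = inner x (op_sqrt S v)" for x v
      by (rule selfadjoint_inner[OF op_sqrt_props(1)[OF S S_pos]])
    fix v
    have "(inner (D u) v)\<^sup>2 \<le> inner (D u) u * inner (D v) v"
      by (rule Cauchy_Schwarz_nonneg_form[OF selfadjoint_inner[OF D(1)] D_form])
    also have "\<dots> \<le> inner (D u) u * (norm (op_sqrt S v))\<^sup>2"
      using \<open>D \<preceq> S\<close> unfolding norm_op_sqrt[OF S S_pos] loewner_le_iff
      by (intro mult_left_mono D_form) auto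
    also have "\<dots> = (sqrt (inner (D u) u) * norm (op_sqrt S v))\<^sup>2"
      by (simp add: power_mult_distrib D_form)
    finally show "inner (D u) v \<le> sqrt (inner (D u) u) * norm (op_sqrt S v)"
      by (rule power2_le_imp_le) (simp add: D_form)
  qed
qed

definition rank_one :: "'a::complex_inner \<Rightarrow> 'a \<Rightarrow>\<^sub>L 'a"
  where "rank_one y = Blinfun (\<lambda>v. cinner v y *\<^sub>C y)"

lemma rank_one_apply: "blinfun_apply (rank_one y) v = cinner v y *\<^sub>C y"
proof -
  have "bounded_linear (\<lambda>v. cinner v y *\<^sub>C y)"
  proof (rule bounded_linear_intro)
    show "cinner (u + v) y *\<^sub>C y = cinner u y *\<^sub>C y + cinner v y *\<^sub>C y" for u v
      by (simp add: cinner_add_left scaleC_add_left)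
    show "cinner (r *\<^sub>R v) y *\<^sub>C y = r *\<^sub>R cinner v y *\<^sub>C y" for r v
      by (simp add: scaleR_scaleC cinner_scaleC_left scaleC_scaleC)
    show "norm (cinner v y *\<^sub>C y) \<le> norm v * (norm y * norm y)" for v
      using mult_right_mono[OF norm_cinner_le[of v y] norm_ge_zero[of y]]
      by (simp add: norm_scaleC mult.assoc)
  qed
  then show ?thesis by (simp add: rank_one_def bounded_linear_Blinfun_apply)
qed

lemma rank_one_form: "inner (blinfun_apply (rank_one y) v) v = (cmod (cinner v y))\<^sup>2"
proof -
  have "inner (rank_one y v) v = Re (cinner v y * cnj (cinner v y))"
    by (metis cinner_commute cinner_scaleC_left inner_eq_Re_cinner rank_one_apply)
  also have "\<dots> = (cmod (cinner v y))\<^sup>2"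
    by (metis Re_complex_of_real complex_norm_square)
  finally show ?thesis .
qed

lemma selfadjoint_rank_one: "rank_one y \<in> selfadjoint_ops"
proof -
  have "cinner (cinner u y *\<^sub>C y) v = cinner u (cinner v y *\<^sub>C y)" for u v
    using cinner_commute[of y v] by (simp add: cinner_scaleC_left cinner_scaleC_right)
  then show ?thesis
    by (simp add: selfadjoint_ops_def rank_one_apply cinner_scaleC_left scaleC_scaleC)
qed

text \<open>If \<open>y = T x\<close> then \<open>(v, y) = (T v, x)\<close>, and \<open>\<parallel>T v\<parallel>\<^sup>2\<close> is the form of \<open>S\<close>; so \<open>C = \<parallel>x\<parallel>\<^sup>2\<close> works.\<close>

lemma rank_one_le_of_range_op_sqrt:
  fixes S :: "'a::chilbert_space \<Rightarrow>\<^sub>L 'a"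
  assumes S: "S \<in> selfadjoint_ops" "0 \<preceq> S" and "y \<in> range (blinfun_apply (op_sqrt S))"
  obtains C where "0 \<le> C" "rank_one y \<preceq> C *\<^sub>R S"
proof -
  obtain x where x: "y = op_sqrt S x" using assms(3) by blast
  have "rank_one y \<preceq> (norm x)\<^sup>2 *\<^sub>R S"
    unfolding loewner_le_iff
  proof
    fix v
    have "cinner v y = cinner (op_sqrt S v) x"
      using op_sqrt_props(1)[OF S] by (simp add: x selfadjoint_ops_def)
    then have "(cmod (cinner v y))\<^sup>2 \<le> (norm (op_sqrt S v) * norm x)\<^sup>2"
      by (simp add: norm_cinner_le power_mono)
    then show "inner (rank_one y v) v \<le> inner (((norm x)\<^sup>2 *\<^sub>R S) v) v"
      by (simp add: rank_one_form power_mult_distrib norm_op_sqrt[OF S] blinfun.scaleR_left mult.commute)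
  qed
  then show ?thesis using that[of "(norm x)\<^sup>2"] by simp
qed

section \<open>Maximal lower bounds\<close>

theorem theorem4p2:
  fixes \<MM> :: "('a::chilbert_space \<Rightarrow>\<^sub>L 'a) set" and M :: "'a \<Rightarrow>\<^sub>L 'a"
  assumes "\<MM> \<noteq> {}"
    and "\<MM> \<subseteq> selfadjoint_ops"
    and "bounded_from_below \<MM>"
    and "is_lower_bound \<MM> M"
  shows "((\<Inter>A\<in>\<MM>. range (blinfun_apply (op_sqrt (A - M)))) = {0}
            \<longrightarrow> is_maximal_lower_bound \<MM> M) \<and>
         (finite \<MM> \<and> (\<Inter>A\<in>\<MM>. range (blinfun_apply (op_sqrt (A - M)))) \<noteq> {0}
            \<longrightarrow> \<not> is_maximal_lower_bound \<MM> M)"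
proof (intro conjI impI)
  have M: "M \<in> selfadjoint_ops" and M_le: "\<And>A. A \<in> \<MM> \<Longrightarrow> M \<preceq> A"
    using assms(4) by (auto simp: is_lower_bound_def)
  have gap: "A - M \<in> selfadjoint_ops" "0 \<preceq> A - M" if "A \<in> \<MM>" for A
    using that M M_le[OF that] assms(2)
    by (auto simp: selfadjoint_diff loewner_le_iff blinfun.diff_left inner_diff_left)
  {
    assume trivial: "(\<Inter>A\<in>\<MM>. range (blinfun_apply (op_sqrt (A - M)))) = {0}"
    have "L = M" if L: "is_lower_bound \<MM> L" "M \<preceq> L" for L
    proof -
      have D: "L - M \<in> selfadjoint_ops" "0 \<preceq> L - M"
        using L M by (auto simp: is_lower_bound_def selfadjoint_diff loewner_le_iff
            blinfun.diff_left inner_diff_left)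
      have "range (L - M) \<subseteq> range (op_sqrt (A - M))" if "A \<in> \<MM>" for A
        using L(1) that by (intro range_le_range_op_sqrt D gap)
          (auto simp: is_lower_bound_def loewner_le_iff blinfun.diff_left inner_diff_left)
      then have "range (L - M) \<subseteq> {0}"
        unfolding trivial[symmetric] by blast
      then have "(L - M) u = 0" for u by blast
      then show ?thesis by (intro blinfun_eqI) (simp add: blinfun.diff_left)
    qed
    then show "is_maximal_lower_bound \<MM> M"
      using assms(4) unfolding is_maximal_lower_bound_def by blast
  }
  {
    assume *: "finite \<MM> \<and> (\<Inter>A\<in>\<MM>. range (blinfun_apply (op_sqrt (A - M)))) \<noteq> {0}"
    note fin = conjunct1[OF *] and nontrivial = conjunct2[OF *]
    have "0 \<in> range (op_sqrt (A - M))" for A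
      by (rule range_eqI[of _ _ 0]) (rule blinfun.zero_right[symmetric])
    then have "{0} \<subseteq> (\<Inter>A\<in>\<MM>. range (blinfun_apply (op_sqrt (A - M))))"
      by (simp add: INT_I)
    then have "{0} \<subset> (\<Inter>A\<in>\<MM>. range (blinfun_apply (op_sqrt (A - M))))"
      using nontrivial by (simp add: psubset_eq)
    then obtain y where y_in: "y \<in> (\<Inter>A\<in>\<MM>. range (blinfun_apply (op_sqrt (A - M)))) - {0}"
      using psubset_imp_ex_mem by metis
    then have "y \<noteq> 0" by simp
    have y: "y \<in> range (op_sqrt (A - M))" if "A \<in> \<MM>" for A
      using y_in that by simp
    have "\<exists>C\<ge>0. rank_one y \<preceq> C *\<^sub>R (A - M)" if "A \<in> \<MM>" for A
      using rank_one_le_of_range_op_sqrt[OF gap[OF that] y[OF that]] by metis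
    then obtain C where C: "\<And>A. A \<in> \<MM> \<Longrightarrow> 0 \<le> C A \<and> rank_one y \<preceq> C A *\<^sub>R (A - M)"
      by metis
    \<comment> \<open>Finiteness enters here: the sum bounds all the constants at once, and the summand \<open>1\<close>
      allows division by \<open>K\<close> even if all of them vanish.\<close>
    define K where "K = 1 + sum C \<MM>"
    have "K > 0" using C by (simp add: K_def add_pos_nonneg sum_nonneg)
    define L where "L = M + (1 / K) *\<^sub>R rank_one y"
    have L_form: "inner (L v) v = inner (M v) v + (cmod (cinner v y))\<^sup>2 / K" for v
      by (simp add: L_def blinfun.add_left blinfun.scaleR_left inner_add_left rank_one_form)
    have "L \<preceq> A" if "A \<in> \<MM>" for A
      unfolding loewner_le_iff
    proof
      fix v
      have "(cmod (cinner v y))\<^sup>2 \<le> C A * inner ((A - M) v) v"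
        using C[OF that] by (auto simp: loewner_le_iff rank_one_form blinfun.scaleR_left)
      also have "\<dots> \<le> K * inner ((A - M) v) v"
      proof (rule mult_right_mono)
        show "C A \<le> K"
          using member_le_sum[of A \<MM> C] that C fin by (auto simp: K_def)
        show "0 \<le> inner ((A - M) v) v"
          using gap(2)[OF that] by (simp add: loewner_le_iff)
      qed
      finally show "inner (L v) v \<le> inner (A v) v"
        using \<open>K > 0\<close> by (simp add: L_form blinfun.diff_left inner_diff_left field_simps)
    qed
    then have "is_lower_bound \<MM> L"
      using M by (simp add: is_lower_bound_def L_def selfadjoint_add selfadjoint_scaleR
          selfadjoint_rank_one)
    moreover have "M \<preceq> L"
      using \<open>K > 0\<close> by (simp add: loewner_le_iff L_form)
    moreover have "L \<noteq> M"
    proof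
      assume "L = M"
      then have "(cmod (cinner y y))\<^sup>2 / K = 0"
        using L_form[of y] by simp
      then show False
        using \<open>K > 0\<close> \<open>y \<noteq> 0\<close> by (simp add: cinner_self)
    qed
    ultimately show "\<not> is_maximal_lower_bound \<MM> M"
      by (auto simp: is_maximal_lower_bound_def)
  }
qed

end
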